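(* (1) If $\preceq$ is a quasi-linear believability relation and $\preceq_{c}$ is constructed from $\preceq$ by: $A \preceq_{c} B$ iff $B = \emptyset$ or there exists $\varphi \in A$ such that $\varphi \preceq \psi$ for every $\psi \in B$, then $\preceq_{c}$ is a standard multi-believability relation, and $\preceq$ can be retrieved from $\preceq_{c}$ by: $\varphi \preceq \psi$ iff $\{\varphi\} \preceq_{c} \{\psi\}$. (2) If $\preceq_{c}$ is a standard multi-believability relation and $\preceq$ is constructed from $\preceq_{c}$ by: $\varphi \preceq \psi$ iff $\{\varphi\} \preceq_{c} \{\psi\}$, then $\preceq$ is a quasi-linear believability relation, and $\preceq_{c}$ can be retrieved from $\preceq$ by: $A \preceq_{c} B$ iff $B = \emptyset$ or there exists $\varphi \in A$ such that $\varphi \preceq \psi$ for every $\psi \in B$.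
   Context: $\mathcal{L}$ is a propositional language with consequence operation $\mathrm{Cn}$ (supraclassical, compact, deduction property); $X\vdash\varphi$ means $\varphi\in\mathrm{Cn}(X)$; $\bot$ is a contradiction. $K$ is a fixed consistent belief set ($K=\mathrm{Cn}(K)$). $A \equiv B$ means every element of $A$ is logically equivalent to some element of $B$ and vice versa. A believability relation $\preceq$ is a binary relation on $\mathcal{L}$ (symmetric part $\simeq$). It is quasi-linear iff it satisfies: transitivity; coupling (if $\varphi \simeq \psi$ then $\varphi \simeq \varphi\wedge\psi$); weak coupling (if $\varphi\simeq\varphi\wedge\psi$ and $\varphi\simeq\varphi\wedge\lambda$ then $\varphi\simeq\varphi\wedge(\psi\wedge\lambda)$); counter dominance (if $\varphi\vdash\psi$ then $\psi\preceq\varphi$); minimality ($\varphi\in K$ iff $\varphi\preceq\psi$ for all $\psi$); maximality (if $\psi\preceq\varphi$ for all $\psi$ then $\varphi$ is logically equivalent to $\bot$); completeness ($\varphi\preceq\psi$ or $\psi\preceq\varphi$). A multi-believability relation $\preceq_{c}$ is a binary relation on finite subsets of $\mathcal{L}$ (symmetric part $\simeq_{c}$, strict part $\prec_{c}$; $\{\varphi\}$ written $\varphi$). It is standard iff it satisfies, for all finite $A,B,C$: transitivity; weak coupling (if $A \simeq_{c} \{\varphi\wedge\psi\mid\varphi\in A,\psi\in B\}$ and $A \simeq_{c} \{\varphi\wedge\chi\mid\varphi\in A,\chi\in C\}$ then $A\simeq_{c}\{(\varphi\wedge\psi)\wedge\chi\mid\varphi\in A,\psi\in B,\chi\in C\}$);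 coupling (if $A\simeq_{c}B$ then $A\simeq_{c}\{\varphi\wedge\psi\mid\varphi\in A,\psi\in B\}$); counter dominance (if for every $\varphi\in B$ there is $\psi\in A$ with $\varphi\vdash\psi$ then $A\preceq_{c}B$); minimality ($A\preceq_{c}B$ for all $B$ iff $A\cap K\neq\emptyset$); maximality (if $B$ is non-empty and $A\preceq_{c}B$ for all non-empty $A$ then $B\equiv\{\bot\}$); completeness ($A\preceq_{c}B$ or $B\preceq_{c}A$); determination ($A\prec_{c}\emptyset$ for every non-empty $A$); union ($A\preceq_{c}A\cup B$ or $B\preceq_{c}A\cup B$). *)

theory Defs
  imports Main "HOL-Library.FSet"
begin

datatype 'p fm =
    Atom 'p
  | Bot
  | Neg "'p fm"
  | And "'p fm" "'p fm"
  | Or "'p fm" "'p fm"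
  | Imp "'p fm" "'p fm"

primrec holds :: "('p \<Rightarrow> bool) \<Rightarrow> 'p fm \<Rightarrow> bool" where
  "holds v (Atom p) = v p"
| "holds v Bot = False"
| "holds v (Neg \<phi>) = (\<not> holds v \<phi>)"
| "holds v (And \<phi> \<psi>) = (holds v \<phi> \<and> holds v \<psi>)"
| "holds v (Or \<phi> \<psi>) = (holds v \<phi> \<or> holds v \<psi>)"
| "holds v (Imp \<phi> \<psi>) = (holds v \<phi> \<longrightarrow> holds v \<psi>)"

definition taut_conseq :: "'p fm set \<Rightarrow> 'p fm \<Rightarrow> bool" where
  "taut_conseq X \<phi> \<longleftrightarrow> (\<forall>v. (\<forall>\<psi>\<in>X. holds v \<psi>) \<longrightarrow> holds v \<phi>)"

(* The first three assumptions are Tarski's conditions on a consequence operation. *)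
locale consequence_operation =
  fixes Cn :: "'p fm set \<Rightarrow> 'p fm set"
  assumes inclusion: "X \<subseteq> Cn X"
    and monotony: "X \<subseteq> Y \<Longrightarrow> Cn X \<subseteq> Cn Y"
    and iteration: "Cn (Cn X) = Cn X"
    and supraclassicality: "taut_conseq X \<phi> \<Longrightarrow> \<phi> \<in> Cn X"
    and compactness: "\<phi> \<in> Cn X \<Longrightarrow> \<exists>Y. finite Y \<and> Y \<subseteq> X \<and> \<phi> \<in> Cn Y"
    and deduction: "\<psi> \<in> Cn (X \<union> {\<phi>}) \<longleftrightarrow> Imp \<phi> \<psi> \<in> Cn X"

locale consistent_belief_set = consequence_operation Cn
  for Cn :: "'p fm set \<Rightarrow> 'p fm set" +
  fixes K :: "'p fm set"
  assumes closed: "K = Cn K"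
    and consistent: "Bot \<notin> Cn K"

definition entails :: "('p fm set \<Rightarrow> 'p fm set) \<Rightarrow> 'p fm \<Rightarrow> 'p fm \<Rightarrow> bool" where
  "entails Cn \<phi> \<psi> \<longleftrightarrow> \<psi> \<in> Cn {\<phi>}"

definition log_equiv :: "('p fm set \<Rightarrow> 'p fm set) \<Rightarrow> 'p fm \<Rightarrow> 'p fm \<Rightarrow> bool" where
  "log_equiv Cn \<phi> \<psi> \<longleftrightarrow> entails Cn \<phi> \<psi> \<and> entails Cn \<psi> \<phi>"

definition set_equiv :: "('p fm set \<Rightarrow> 'p fm set) \<Rightarrow> 'p fm fset \<Rightarrow> 'p fm fset \<Rightarrow> bool" where
  "set_equiv Cn A B \<longleftrightarrow>
     (\<forall>\<phi>. \<phi> |\<in>| A \<longrightarrow> (\<exists>\<psi>. \<psi> |\<in>| B \<and> log_equiv Cn \<phi> \<psi>)) \<and>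
     (\<forall>\<psi>. \<psi> |\<in>| B \<longrightarrow> (\<exists>\<phi>. \<phi> |\<in>| A \<and> log_equiv Cn \<psi> \<phi>))"

definition sym_part :: "('a \<Rightarrow> 'a \<Rightarrow> bool) \<Rightarrow> 'a \<Rightarrow> 'a \<Rightarrow> bool" where
  "sym_part r x y \<longleftrightarrow> r x y \<and> r y x"

definition strict_part :: "('a \<Rightarrow> 'a \<Rightarrow> bool) \<Rightarrow> 'a \<Rightarrow> 'a \<Rightarrow> bool" where
  "strict_part r x y \<longleftrightarrow> r x y \<and> \<not> r y x"

definition fconj :: "'p fm fset \<Rightarrow> 'p fm fset \<Rightarrow> 'p fm fset" where
  "fconj A B = ffUnion ((\<lambda>\<phi>. And \<phi> |`| B) |`| A)"

lemma fset_fconj: "fset (fconj A B) = {And \<phi> \<psi> |\<phi> \<psi>. \<phi> |\<in>| A \<and> \<psi> |\<in>| B}"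
  unfolding fconj_def by (auto simp: ffUnion.rep_eq)

lemma fset_fconj_fconj:
  "fset (fconj (fconj A B) C) =
     {And (And \<phi> \<psi>) \<chi> |\<phi> \<psi> \<chi>. \<phi> |\<in>| A \<and> \<psi> |\<in>| B \<and> \<chi> |\<in>| C}"
  unfolding fset_fconj by (auto simp: fset_fconj)

locale quasi_linear =
  fixes Cn :: "'p fm set \<Rightarrow> 'p fm set"
    and K :: "'p fm set"
    and le :: "'p fm \<Rightarrow> 'p fm \<Rightarrow> bool"
  assumes transitivity: "le \<phi> \<psi> \<Longrightarrow> le \<psi> \<chi> \<Longrightarrow> le \<phi> \<chi>"
    and coupling: "sym_part le \<phi> \<psi> \<Longrightarrow> sym_part le \<phi> (And \<phi> \<psi>)"
    and weak_coupling:
      "sym_part le \<phi> (And \<phi> \<psi>) \<Longrightarrow> sym_part le \<phi> (And \<phi> \<chi>) \<Longrightarrow>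
       sym_part le \<phi> (And \<phi> (And \<psi> \<chi>))"
    and counter_dominance: "entails Cn \<phi> \<psi> \<Longrightarrow> le \<psi> \<phi>"
    and minimality: "\<phi> \<in> K \<longleftrightarrow> (\<forall>\<psi>. le \<phi> \<psi>)"
    and maximality: "(\<And>\<psi>. le \<psi> \<phi>) \<Longrightarrow> log_equiv Cn \<phi> Bot"
    and completeness: "le \<phi> \<psi> \<or> le \<psi> \<phi>"

locale standard_multi =
  fixes Cn :: "'p fm set \<Rightarrow> 'p fm set"
    and K :: "'p fm set"
    and lec :: "'p fm fset \<Rightarrow> 'p fm fset \<Rightarrow> bool"
  assumes transitivity: "lec A B \<Longrightarrow> lec B C \<Longrightarrow> lec A C"
    and weak_coupling:
      "sym_part lec A (fconj A B) \<Longrightarrow> sym_part lec A (fconj A C) \<Longrightarrow>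
       sym_part lec A (fconj (fconj A B) C)"
    and coupling: "sym_part lec A B \<Longrightarrow> sym_part lec A (fconj A B)"
    and counter_dominance:
      "(\<And>\<phi>. \<phi> |\<in>| B \<Longrightarrow> \<exists>\<psi>. \<psi> |\<in>| A \<and> entails Cn \<phi> \<psi>) \<Longrightarrow> lec A B"
    and minimality: "(\<forall>B. lec A B) \<longleftrightarrow> fset A \<inter> K \<noteq> {}"
    and maximality:
      "B \<noteq> {||} \<Longrightarrow> (\<And>A. A \<noteq> {||} \<Longrightarrow> lec A B) \<Longrightarrow> set_equiv Cn B {|Bot|}"
    and completeness: "lec A B \<or> lec B A"
    and determination: "A \<noteq> {||} \<Longrightarrow> strict_part lec A {||}"
    and union: "lec A (A |\<union>| B) \<or> lec B (A |\<union>| B)"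

definition multi_of :: "('p fm \<Rightarrow> 'p fm \<Rightarrow> bool) \<Rightarrow> 'p fm fset \<Rightarrow> 'p fm fset \<Rightarrow> bool" where
  "multi_of le A B \<longleftrightarrow>
     B = {||} \<or> (\<exists>\<phi>. \<phi> |\<in>| A \<and> (\<forall>\<psi>. \<psi> |\<in>| B \<longrightarrow> le \<phi> \<psi>))"

definition single_of :: "('p fm fset \<Rightarrow> 'p fm fset \<Rightarrow> bool) \<Rightarrow> 'p fm \<Rightarrow> 'p fm \<Rightarrow> bool" where
  "single_of lec \<phi> \<psi> \<longleftrightarrow> lec {|\<phi>|} {|\<psi>|}"

end

theory Submission
  imports Defs
begin

text \<open>
  Every finite set of sentences behaves like its most believable element. If \<open>\<preceq>\<close> is quasi-linear,
  a non-empty finite set has a \<open>\<preceq>\<close>-least element, and \<open>A \<preceq>\<^sub>c B\<close> compares these least elements.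
  Conversely, for a standard \<open>\<preceq>\<^sub>c\<close> the union postulate yields, by induction on the set, an element
  \<open>\<phi>\<close> of \<open>A\<close> with \<open>{\<phi>} \<preceq>\<^sub>c A\<close>, so \<open>\<preceq>\<^sub>c\<close> is determined by its restriction to singletons.
  The one delicate postulate is weak coupling for \<open>\<preceq>\<^sub>c\<close>: its two premises may be witnessed by
  different elements of \<open>A\<close>; both are least in \<open>A\<close>, so coupling combines the witnesses.
\<close>

section \<open>Consequence, the belief set and conjunction sets\<close>

lemma (in consequence_operation) entails_taut:
  assumes "\<And>v. holds v \<phi> \<Longrightarrow> holds v \<psi>"
  shows "entails Cn \<phi> \<psi>"
  unfolding entails_def
  using assms by (intro supraclassicality) (simp add: taut_conseq_def)

lemma (in consistent_belief_set) tautology_in_K: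
  assumes "\<And>v. holds v \<phi>"
  shows "\<phi> \<in> K"
  using supraclassicality[of K \<phi>] closed assms by (simp add: taut_conseq_def)

text \<open>Minimality quantifies over sentences in one postulate and over finite sets in the other.
  An element of \<open>K\<close> is below everything in either sense, so comparison with it alone
  carries the postulate across.\<close>

lemma (in consistent_belief_set) K_nonempty: "\<exists>\<phi>. \<phi> \<in> K"
  using tautology_in_K[of "Neg Bot"] by auto

lemma in_fconj: "\<chi> |\<in>| fconj A B \<longleftrightarrow> (\<exists>\<phi> \<psi>. \<chi> = And \<phi> \<psi> \<and> \<phi> |\<in>| A \<and> \<psi> |\<in>| B)"
  using fset_fconj[of A B] by (auto simp: set_eq_iff)

text \<open>Lets the coupling postulates for finite sets, taken at singletons, be read as postulates
  for sentences.\<close>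

lemma fconj_singletons: "fconj {|\<phi>|} {|\<psi>|} = {|And \<phi> \<psi>|}"
  by (auto simp: in_fconj)

lemma multi_of_singletons: "multi_of le {|\<phi>|} {|\<psi>|} \<longleftrightarrow> le \<phi> \<psi>"
  by (auto simp: multi_of_def)

section \<open>From sentences to finite sets\<close>

lemma (in quasi_linear) ex_least:
  assumes "A \<noteq> {||}"
  shows "\<exists>\<phi>. \<phi> |\<in>| A \<and> (\<forall>\<psi>. \<psi> |\<in>| A \<longrightarrow> le \<phi> \<psi>)"
  using assms
proof (induction A)
  case empty
  then show ?case by simp
next
  case (insert x A)
  have refl: "le x x" using completeness by blast
  show ?case
  proof (cases "A = {||}")
    case True
    then show ?thesis using refl by auto
  next
    case False
    with insert.IH obtain \<phi> where "\<phi> |\<in>| A" "\<forall>\<psi>. \<psi> |\<in>| A \<longrightarrow> le \<phi> \<psi>" by blast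
    \<comment> \<open>By completeness, one of \<open>x\<close> and the least element
      \<open>\<phi>\<close> of \<open>A\<close> is below the other; that one is least in
      \<open>finsert x A\<close>.\<close>
    then show ?thesis
      using completeness[of x \<phi>] refl transitivity[of x \<phi>] by (metis finsert_iff)
  qed
qed

lemma standard_multi_multi_of:
  assumes "consistent_belief_set Cn K" and "quasi_linear Cn K le"
  shows "standard_multi Cn K (multi_of le)"
proof -
  interpret consistent_belief_set Cn K by fact
  interpret Q: quasi_linear Cn K le by fact
  have trans: "multi_of le A C" if "multi_of le A B" "multi_of le B C" for A B C
    using that Q.transitivity unfolding multi_of_def by (metis fempty_iff)
  have dominance: "multi_of le A B"
    if dom: "\<And>\<phi>. \<phi> |\<in>| B \<Longrightarrow> \<exists>\<psi>. \<psi> |\<in>| A \<and> entails Cn \<phi> \<psi>" for A B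
  proof (cases "B = {||}")
    case False
    then have "A \<noteq> {||}" using dom by fastforce
    \<comment> \<open>A least element of \<open>A\<close> is the witness: each member of
      \<open>B\<close> entails some member of \<open>A\<close>, hence lies above it and so above
      \<open>a\<close>.\<close>
    with Q.ex_least obtain a where "a |\<in>| A" "\<And>\<psi>. \<psi> |\<in>| A \<Longrightarrow> le a \<psi>" by blast
    then show ?thesis
      using dom Q.counter_dominance Q.transitivity unfolding multi_of_def by metis
  qed (simp add: multi_of_def)
  have dom_fconj: "multi_of le A (fconj A B)" for A B
  proof (rule dominance)
    fix \<chi>
    assume "\<chi> |\<in>| fconj A B"
    then obtain a b where "\<chi> = And a b" "a |\<in>| A" by (auto simp: in_fconj)
    then show "\<exists>\<psi>. \<psi> |\<in>| A \<and> entails Cn \<chi> \<psi>"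
      using entails_taut[of \<chi> a] by auto
  qed
  have dom_fconj2: "multi_of le A (fconj (fconj A B) C)" for A B C
    using dom_fconj trans by blast
  show ?thesis
  proof
    show "multi_of le A C" if "multi_of le A B" "multi_of le B C" for A B C
      using that by (rule trans)
  next
    fix A B C
    assume "sym_part (multi_of le) A (fconj A B)" "sym_part (multi_of le) A (fconj A C)"
    then have AB: "multi_of le (fconj A B) A" and AC: "multi_of le (fconj A C) A"
      by (auto simp: sym_part_def)
    have "multi_of le (fconj (fconj A B) C) A"
    proof (cases "A = {||}")
      case False
      obtain a b where a: "a |\<in>| A" and b: "b |\<in>| B"
        and ab: "\<And>\<psi>. \<psi> |\<in>| A \<Longrightarrow> le (And a b) \<psi>"
        using AB False unfolding multi_of_def in_fconj by blast
      obtain a' c where a': "a' |\<in>| A" and c: "c |\<in>| C"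
        and ac: "\<And>\<psi>. \<psi> |\<in>| A \<Longrightarrow> le (And a' c) \<psi>"
        using AC False unfolding multi_of_def in_fconj by blast
      \<comment> \<open>In the cycle \<open>And a b\<close>, \<open>a'\<close>,
        \<open>And a' c\<close>, \<open>a\<close>, \<open>And a b\<close> each sentence is at most
        the next, so the two witnesses are equivalent and coupling applies.\<close>
      have "le a (And a b)" "le a' (And a' c)"
        by (rule Q.counter_dominance, rule entails_taut, simp)+
      then have "sym_part le (And a b) (And a' c)"
        using ab[OF a'] ac[OF a] Q.transitivity unfolding sym_part_def by blast
      then have 1: "le (And (And a b) (And a' c)) (And a b)"
        using Q.coupling unfolding sym_part_def by blast
      \<comment> \<open>Members of \<open>fconj (fconj A B) C\<close> contain one element of
        \<open>A\<close> only; the merged conjunction entails the one obtained by dropping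
        \<open>a'\<close>.\<close>
      have 2: "le (And (And a b) c) (And (And a b) (And a' c))"
        by (rule Q.counter_dominance, rule entails_taut) simp
      have "le (And (And a b) c) \<psi>" if "\<psi> |\<in>| A" for \<psi>
        using 1 2 ab[OF that] Q.transitivity by blast
      moreover have "And (And a b) c |\<in>| fconj (fconj A B) C"
        using a b c by (auto simp: in_fconj)
      ultimately show ?thesis unfolding multi_of_def by blast
    qed (simp add: multi_of_def)
    then show "sym_part (multi_of le) A (fconj (fconj A B) C)"
      using dom_fconj2 by (simp add: sym_part_def)
  next
    fix A B
    assume "sym_part (multi_of le) A B"
    then have AB: "multi_of le A B" and BA: "multi_of le B A"
      by (auto simp: sym_part_def)
    have "multi_of le (fconj A B) A"
    proof (cases "A = {||}")
      case False
      then obtain b where b: "b |\<in>| B" "\<And>\<psi>. \<psi> |\<in>| A \<Longrightarrow> le b \<psi>"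
        using BA unfolding multi_of_def by blast
      then obtain a where a: "a |\<in>| A" "\<And>\<psi>. \<psi> |\<in>| B \<Longrightarrow> le a \<psi>"
        using AB unfolding multi_of_def by blast
      \<comment> \<open>\<open>a\<close> is below \<open>b\<close> as \<open>b\<close> is in
        \<open>B\<close>, and \<open>b\<close> is below \<open>a\<close> as \<open>a\<close> is in
        \<open>A\<close>; coupling applies to this equivalent pair.\<close>
      have "le (And a b) a"
        using a b Q.coupling[of a b] unfolding sym_part_def by blast
      moreover have "le a \<psi>" if "\<psi> |\<in>| A" for \<psi>
        using a(2)[OF b(1)] b(2)[OF that] Q.transitivity by blast
      ultimately show ?thesis
        using a(1) b(1) Q.transitivity unfolding multi_of_def in_fconj by blast
    qed (simp add: multi_of_def)
    then show "sym_part (multi_of le) A (fconj A B)"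
      using dom_fconj by (simp add: sym_part_def)
  next
    show "multi_of le A B"
      if "\<And>\<phi>. \<phi> |\<in>| B \<Longrightarrow> \<exists>\<psi>. \<psi> |\<in>| A \<and> entails Cn \<phi> \<psi>" for A B
      using that by (rule dominance)
  next
    fix A
    show "(\<forall>B. multi_of le A B) \<longleftrightarrow> fset A \<inter> K \<noteq> {}"
    proof
      assume all: "\<forall>B. multi_of le A B"
      obtain k where k: "k \<in> K" using K_nonempty by blast
      then have "\<And>\<psi>. le k \<psi>" using Q.minimality by blast
      \<comment> \<open>The test set \<open>{|k|}\<close> suffices: \<open>k\<close> is below every
        sentence, so \<open>a\<close> is as well.\<close>
      moreover obtain a where "a |\<in>| A" "le a k"
        using spec[OF all, of "{|k|}"] by (auto simp: multi_of_def)
      ultimately show "fset A \<inter> K \<noteq> {}"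
        using Q.minimality[of a] Q.transitivity by blast
    next
      assume "fset A \<inter> K \<noteq> {}"
      then show "\<forall>B. multi_of le A B"
        using Q.minimality unfolding multi_of_def by blast
    qed
  next
    fix B
    assume B: "B \<noteq> {||}" and max: "\<And>A. A \<noteq> {||} \<Longrightarrow> multi_of le A B"
    have "log_equiv Cn \<phi> Bot" if "\<phi> |\<in>| B" for \<phi>
    proof (rule Q.maximality)
      show "le \<psi> \<phi>" for \<psi>
        using max[of "{|\<psi>|}"] that by (auto simp: multi_of_def)
    qed
    then show "set_equiv Cn B {|Bot|}"
      using B unfolding set_equiv_def log_equiv_def by auto
  next
    show "multi_of le A B \<or> multi_of le B A" for A B
    proof (cases "A = {||} \<or> B = {||}")
      case False
      then obtain a b where a: "a |\<in>| A" "\<And>\<psi>. \<psi> |\<in>| A \<Longrightarrow> le a \<psi>"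
        and b: "b |\<in>| B" "\<And>\<psi>. \<psi> |\<in>| B \<Longrightarrow> le b \<psi>"
        using Q.ex_least by metis
      then show ?thesis
        using Q.completeness[of a b] Q.transitivity unfolding multi_of_def by metis
    qed (auto simp: multi_of_def)
  next
    show "strict_part (multi_of le) A {||}" if "A \<noteq> {||}" for A
      using that by (auto simp: strict_part_def multi_of_def)
  next
    \<comment> \<open>A least element of the union lies in \<open>A\<close> or in \<open>B\<close>
      and witnesses that disjunct; for an empty union both hold trivially.\<close>
    show "multi_of le A (A |\<union>| B) \<or> multi_of le B (A |\<union>| B)" for A B
      using Q.ex_least[of "A |\<union>| B"] unfolding multi_of_def by (metis funion_iff)
  qed
qed

section \<open>From finite sets to sentences\<close>

lemma (in standard_multi) ex_representative:
  assumes "A \<noteq> {||}"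
  shows "\<exists>\<phi>. \<phi> |\<in>| A \<and> lec {|\<phi>|} A"
  using assms
proof (induction A)
  case empty
  then show ?case by simp
next
  case (insert x A)
  show ?case
  proof (cases "A = {||}")
    case True
    then show ?thesis using completeness by auto
  next
    case False
    with insert.IH obtain \<phi> where "\<phi> |\<in>| A" "lec {|\<phi>|} A" by blast
    \<comment> \<open>Union for \<open>{|x|}\<close> and \<open>A\<close>: either \<open>x\<close>
      itself represents \<open>finsert x A\<close>, or \<open>A\<close> is below it and so is
      \<open>{|\<phi>|}\<close>.\<close>
    then show ?thesis
      using union[of "{|x|}" A] transitivity[of "{|\<phi>|}" A "finsert x A"] by auto
  qed
qed

lemma quasi_linear_single_of:
  assumes "consistent_belief_set Cn K" and "standard_multi Cn K lec"
  shows "quasi_linear Cn K (single_of lec)"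
proof -
  interpret consistent_belief_set Cn K by fact
  interpret S: standard_multi Cn K lec by fact
  have dominance: "lec {|\<psi>|} {|\<phi>|}" if "entails Cn \<phi> \<psi>" for \<phi> \<psi>
    using that by (intro S.counter_dominance) auto
  show ?thesis
  proof
    show "single_of lec \<phi> \<chi>" if "single_of lec \<phi> \<psi>" "single_of lec \<psi> \<chi>" for \<phi> \<psi> \<chi>
      using that S.transitivity unfolding single_of_def by blast
  next
    show "sym_part (single_of lec) \<phi> (And \<phi> \<psi>)" if "sym_part (single_of lec) \<phi> \<psi>" for \<phi> \<psi>
      using that S.coupling[of "{|\<phi>|}" "{|\<psi>|}"]
      by (simp add: single_of_def sym_part_def fconj_singletons)
  next
    fix \<phi> \<psi> \<chi>
    assume "sym_part (single_of lec) \<phi> (And \<phi> \<psi>)" "sym_part (single_of lec) \<phi> (And \<phi> \<chi>)"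
    then have "sym_part lec {|\<phi>|} {|And (And \<phi> \<psi>) \<chi>|}"
      using S.weak_coupling[of "{|\<phi>|}" "{|\<psi>|}" "{|\<chi>|}"]
      by (simp add: single_of_def sym_part_def fconj_singletons)
    \<comment> \<open>\<open>fconj\<close> brackets to the left, weak coupling for sentences to the
      right; the two forms entail each other.\<close>
    moreover have "sym_part lec {|And (And \<phi> \<psi>) \<chi>|} {|And \<phi> (And \<psi> \<chi>)|}"
      unfolding sym_part_def by (auto intro!: dominance entails_taut)
    ultimately show "sym_part (single_of lec) \<phi> (And \<phi> (And \<psi> \<chi>))"
      using S.transitivity unfolding single_of_def sym_part_def by blast
  next
    show "single_of lec \<psi> \<phi>" if "entails Cn \<phi> \<psi>" for \<phi> \<psi>
      using dominance[OF that] by (simp add: single_of_def)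
  next
    fix \<phi>
    have K_iff: "\<psi> \<in> K \<longleftrightarrow> (\<forall>B. lec {|\<psi>|} B)" for \<psi>
      using S.minimality[of "{|\<psi>|}"] by simp
    obtain k where "k \<in> K" using K_nonempty by blast
    then show "\<phi> \<in> K \<longleftrightarrow> (\<forall>\<psi>. single_of lec \<phi> \<psi>)"
      using K_iff S.transitivity unfolding single_of_def by meson
  next
    fix \<phi>
    assume max: "\<And>\<psi>. single_of lec \<psi> \<phi>"
    \<comment> \<open>Maximality for sets compares with every non-empty \<open>A\<close>; any member
      \<open>\<psi>\<close> links \<open>A\<close> to \<open>{|\<psi>|}\<close> and thence to
      \<open>{|\<phi>|}\<close>.\<close>
    have "lec A {|\<phi>|}" if A: "A \<noteq> {||}" for A
    proof -
      obtain \<psi> where "\<psi> |\<in>| A" using A by blast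
      then have "lec A {|\<psi>|}"
        by (intro S.counter_dominance) (auto intro: entails_taut)
      then show ?thesis
        using max S.transitivity unfolding single_of_def by blast
    qed
    then have "set_equiv Cn {|\<phi>|} {|Bot|}"
      by (intro S.maximality) auto
    then show "log_equiv Cn \<phi> Bot" by (simp add: set_equiv_def)
  next
    show "single_of lec \<phi> \<psi> \<or> single_of lec \<psi> \<phi>" for \<phi> \<psi>
      using S.completeness by (simp add: single_of_def)
  qed
qed

text \<open>A non-empty set is below the singleton of each member, by counter dominance, and above
  the singleton of its representative. Comparisons of non-empty sets thus pass through
  singletons.\<close>

lemma multi_of_single_of:
  assumes "consistent_belief_set Cn K" and "standard_multi Cn K lec"
  shows "multi_of (single_of lec) A B \<longleftrightarrow> lec A B"
proof -
  interpret consistent_belief_set Cn K by fact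
  interpret S: standard_multi Cn K lec by fact
  have elem: "lec A {|\<psi>|}" if "\<psi> |\<in>| A" for A \<psi>
    using that by (intro S.counter_dominance) (auto intro: entails_taut)
  show ?thesis
  proof (cases "B = {||}")
    case True
    moreover have "lec A {||}" by (rule S.counter_dominance) simp
    ultimately show ?thesis by (simp add: multi_of_def)
  next
    case B: False
    show ?thesis
    proof
      assume "lec A B"
      \<comment> \<open>Determination forbids \<open>{||}\<close> from being below the non-empty
        \<open>B\<close>.\<close>
      then have "A \<noteq> {||}"
        using S.determination[OF B] by (auto simp: strict_part_def)
      then obtain a where "a |\<in>| A" "lec {|a|} A" using S.ex_representative by blast
      \<comment> \<open>The chain is \<open>{|a|}\<close>, \<open>A\<close>, \<open>B\<close>,
        \<open>{|\<psi>|}\<close> for each \<open>\<psi>\<close> in \<open>B\<close>.\<close>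
      then show "multi_of (single_of lec) A B"
        using S.transitivity[OF S.transitivity[OF _ \<open>lec A B\<close>] elem]
        unfolding multi_of_def single_of_def by blast
    next
      assume "multi_of (single_of lec) A B"
      then obtain a where a: "a |\<in>| A" "\<And>\<psi>. \<psi> |\<in>| B \<Longrightarrow> lec {|a|} {|\<psi>|}"
        using B unfolding multi_of_def single_of_def by blast
      \<comment> \<open>The representative of \<open>B\<close> closes the chain \<open>A\<close>,
        \<open>{|a|}\<close>, \<open>{|b|}\<close>, \<open>B\<close>.\<close>
      obtain b where b: "b |\<in>| B" "lec {|b|} B" using S.ex_representative[OF B] by blast
      have "lec {|a|} B" by (rule S.transitivity[OF a(2)[OF b(1)] b(2)])
      then show "lec A B" by (rule S.transitivity[OF elem[OF a(1)]])
    qed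
  qed
qed

theorem theorem3:
  fixes Cn :: "'p fm set \<Rightarrow> 'p fm set" and K :: "'p fm set"
  assumes "consistent_belief_set Cn K"
  shows "(\<forall>le lec. quasi_linear Cn K le \<and> (\<forall>A B. lec A B \<longleftrightarrow> multi_of le A B) \<longrightarrow>
            standard_multi Cn K lec \<and> (\<forall>\<phi> \<psi>. le \<phi> \<psi> \<longleftrightarrow> single_of lec \<phi> \<psi>)) \<and>
         (\<forall>lec le. standard_multi Cn K lec \<and> (\<forall>\<phi> \<psi>. le \<phi> \<psi> \<longleftrightarrow> single_of lec \<phi> \<psi>) \<longrightarrow>
            quasi_linear Cn K le \<and> (\<forall>A B. lec A B \<longleftrightarrow> multi_of le A B))"
proof (intro conjI allI impI; elim conjE)
  fix le lec
  assume le: "quasi_linear Cn K le" and "\<forall>A B. lec A B \<longleftrightarrow> multi_of le A B"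
  \<comment> \<open>Extensionality turns the pointwise construction into an equation of
    relations.\<close>
  then have lec: "lec = multi_of le" by (intro ext) simp
  show "standard_multi Cn K lec"
    unfolding lec using assms le by (rule standard_multi_multi_of)
  show "le \<phi> \<psi> \<longleftrightarrow> single_of lec \<phi> \<psi>" for \<phi> \<psi>
    by (simp add: lec single_of_def multi_of_singletons)
next
  fix lec le
  assume lec: "standard_multi Cn K lec" and "\<forall>\<phi> \<psi>. le \<phi> \<psi> \<longleftrightarrow> single_of lec \<phi> \<psi>"
  then have le: "le = single_of lec" by (intro ext) simp
  show "quasi_linear Cn K le"
    unfolding le using assms lec by (rule quasi_linear_single_of)
  show "lec A B \<longleftrightarrow> multi_of le A B" for A B
    unfolding le using multi_of_single_of[OF assms lec] by simp
qed

end
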